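(* Let $\kappa$ be either $\omega$ or a measurable cardinal. For any $\kappa$-complete (uniform) ultrafilter $U$ over $\kappa$, $(U,\supseteq^* )\equiv_T([2^\kappa]^{<\kappa},\subseteq)$ if and only if $\neg\mathrm{Gal}^*(U,\kappa,2^\kappa)$.
   Context: For $X,Y\subseteq\kappa$, $X\subseteq^*Y$ means $X\setminus Y$ is bounded in $\kappa$; $(U,\supseteq^* )$ is $U$ ordered by $A\le B$ iff $B\subseteq^* A$. For directed posets, $P\le_T Q$ means there is a map $P\to Q$ sending unbounded subsets to unbounded subsets; $P\equiv_T Q$ means both $P\le_T Q$ and $Q\le_T P$. $[2^\kappa]^{<\kappa}$ is the set of subsets of $2^\kappa$ of size $<\kappa$ ordered by inclusion. For an ultrafilter $U$ over $\kappa$ and cardinals $\mu\le\lambda$, $\mathrm{Gal}^*(U,\mu,\lambda)$ means: for every sequence $\langle A_i\mid i<\lambda\rangle$ of (distinct) members of $U$ there is $I\subseteq\lambda$ with $|I|=\mu$ such that $\langle A_i\mid i\in I\rangle$ has a pseudointersection in $U$, i.e. some $X\in U$ with $X\subseteq^*A_i$ for all $i\in I$. *)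

theory Defs
  imports Main
begin

unbundle cardinal_syntax

text \<open>
  A cardinal \<open>\<kappa>\<close> is a relation with \<open>Card_order \<kappa>\<close>, i.e. an initial well-order; its
  underlying set of ordinals is \<open>Field \<kappa>\<close>, and \<open>(a, b) \<in> \<kappa>\<close> is the (reflexive) order.
\<close>

definition bounded_in :: "'a rel \<Rightarrow> 'a set \<Rightarrow> bool" where
  "bounded_in \<kappa> Z \<longleftrightarrow> (\<exists>b \<in> Field \<kappa>. \<forall>z \<in> Z. (z, b) \<in> \<kappa>)"

definition subset_star :: "'a rel \<Rightarrow> 'a set \<Rightarrow> 'a set \<Rightarrow> bool" where
  "subset_star \<kappa> X Y \<longleftrightarrow> bounded_in \<kappa> (X - Y)"

definition supset_star :: "'a rel \<Rightarrow> 'a set \<Rightarrow> 'a set \<Rightarrow> bool" where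
  "supset_star \<kappa> A B \<longleftrightarrow> subset_star \<kappa> B A"

definition ultrafilter_over :: "'a set \<Rightarrow> 'a set set \<Rightarrow> bool" where
  "ultrafilter_over S U \<longleftrightarrow>
     U \<subseteq> Pow S \<and> S \<in> U \<and> {} \<notin> U \<and>
     (\<forall>X \<in> U. \<forall>Y. X \<subseteq> Y \<and> Y \<subseteq> S \<longrightarrow> Y \<in> U) \<and>
     (\<forall>X \<in> U. \<forall>Y \<in> U. X \<inter> Y \<in> U) \<and>
     (\<forall>X. X \<subseteq> S \<longrightarrow> X \<in> U \<or> S - X \<in> U)"

definition complete_filter :: "'k rel \<Rightarrow> 'a set set \<Rightarrow> bool" where
  "complete_filter \<kappa> U \<longleftrightarrow> (\<forall>F. F \<subseteq> U \<and> F \<noteq> {} \<and> |F| <o \<kappa> \<longrightarrow> \<Inter>F \<in> U)"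

definition nonprincipal_over :: "'a set \<Rightarrow> 'a set set \<Rightarrow> bool" where
  "nonprincipal_over S U \<longleftrightarrow> (\<forall>x \<in> S. {x} \<notin> U)"

definition uniform_filter :: "'a rel \<Rightarrow> 'a set set \<Rightarrow> bool" where
  "uniform_filter \<kappa> U \<longleftrightarrow> (\<forall>X \<in> U. |X| =o \<kappa>)"

definition measurable_cardinal :: "'a rel \<Rightarrow> bool" where
  "measurable_cardinal \<kappa> \<longleftrightarrow>
     Card_order \<kappa> \<and> natLeq <o \<kappa> \<and>
     (\<exists>U. ultrafilter_over (Field \<kappa>) U \<and> complete_filter \<kappa> U \<and> nonprincipal_over (Field \<kappa>) U)"

text \<open>Orders are given by a carrier set and a relation on it.\<close>

definition unbounded_subset :: "'p set \<Rightarrow> ('p \<Rightarrow> 'p \<Rightarrow> bool) \<Rightarrow> 'p set \<Rightarrow> bool" where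
  "unbounded_subset P le X \<longleftrightarrow> X \<subseteq> P \<and> \<not> (\<exists>b \<in> P. \<forall>x \<in> X. le x b)"

definition tukey_le ::
  "'p set \<Rightarrow> ('p \<Rightarrow> 'p \<Rightarrow> bool) \<Rightarrow> 'q set \<Rightarrow> ('q \<Rightarrow> 'q \<Rightarrow> bool) \<Rightarrow> bool" where
  "tukey_le P leP Q leQ \<longleftrightarrow>
     (\<exists>f. f ` P \<subseteq> Q \<and> (\<forall>X. unbounded_subset P leP X \<longrightarrow> unbounded_subset Q leQ (f ` X)))"

definition tukey_equiv ::
  "'p set \<Rightarrow> ('p \<Rightarrow> 'p \<Rightarrow> bool) \<Rightarrow> 'q set \<Rightarrow> ('q \<Rightarrow> 'q \<Rightarrow> bool) \<Rightarrow> bool" where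
  "tukey_equiv P leP Q leQ \<longleftrightarrow> tukey_le P leP Q leQ \<and> tukey_le Q leQ P leP"

definition small_subsets :: "'i rel \<Rightarrow> 'k rel \<Rightarrow> 'i set set" where
  "small_subsets \<nu> \<kappa> = {S. S \<subseteq> Field \<nu> \<and> |S| <o \<kappa>}"

text \<open>The cardinal \<open>\<kappa>\<close> enters \<open>Gal_star\<close> only through the relation \<open>subset_star \<kappa>\<close>.\<close>

definition Gal_star :: "'a rel \<Rightarrow> 'a set set \<Rightarrow> 'm rel \<Rightarrow> 'i rel \<Rightarrow> bool" where
  "Gal_star \<kappa> U \<mu> \<nu> \<longleftrightarrow>
     (\<forall>A. A ` Field \<nu> \<subseteq> U \<and> inj_on A (Field \<nu>) \<longrightarrow>
        (\<exists>I. I \<subseteq> Field \<nu> \<and> |I| =o \<mu> \<and> (\<exists>X \<in> U. \<forall>i \<in> I. subset_star \<kappa> X (A i))))"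

end

theory Submission
  imports Defs
begin

text \<open>
  For a \<open>\<kappa>\<close>-directed order \<open>P\<close>, a reduction \<open>[\<nu>]\<^sup><\<^sup>\<kappa> \<le>\<^sub>T P\<close> amounts to a family of \<open>\<nu>\<close> points of
  \<open>P\<close> all of whose subfamilies of size \<open>\<kappa>\<close> are unbounded: restrict the reduction to singletons,
  or conversely send \<open>S\<close> to an upper bound of the points indexed by \<open>S\<close>. The fibres of such a
  family have size below \<open>\<kappa>\<close>, so if \<open>\<kappa> < \<nu>\<close> it can be thinned out and reindexed to consist of distinct
  points. For \<open>P = (U, \<supseteq>\<^sup>*)\<close> and \<open>\<nu> = 2\<^sup>\<kappa>\<close> such families are the counterexamples to \<open>Gal\<^sup>*\<close>.
  The reduction \<open>P \<le>\<^sub>T [\<nu>]\<^sup><\<^sup>\<kappa>\<close> sends points to singletons and only needs \<open>|P| \<le> \<nu>\<close>.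
\<close>

lemma not_card_of_ordLess_iff:
  assumes "Card_order \<kappa>"
  shows "\<not> |X| <o \<kappa> \<longleftrightarrow> \<kappa> \<le>o |X|"
  using assms card_of_Well_order card_order_on_well_order_on by (intro not_ordLess_iff_ordLeq) blast+

lemma card_of_inj_image:
  assumes "inj_on f A"
  shows "|A| =o |f ` A|"
  using inj_on_imp_bij_betw[OF assms] by (rule card_of_ordIsoI)

lemma card_of_Pow_Field_ordIso:
  "|Pow (Field \<kappa>)| =o |Field (ctwo ^c \<kappa>)|"
  using card_of_Pow_Func by (simp add: cexp_def ctwo_def Field_card_of)

lemma Cinfinite_if_measurable_cardinal:
  assumes "measurable_cardinal \<kappa>"
  shows "Cinfinite \<kappa>"
  using assms cinfinite_mono[OF ordLess_imp_ordLeq natLeq_cinfinite]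
  by (auto simp: measurable_cardinal_def)

lemma card_of_image_if_small_fibres:
  assumes "Cinfinite \<kappa>" and "\<kappa> <o |I|"
    and fibres: "\<And>p. p \<in> A ` I \<Longrightarrow> |{i \<in> I. A i = p}| \<le>o \<kappa>"
  shows "|A ` I| =o |I|"
proof -
  have fibres_cover: "(\<Union>p \<in> A ` I. {i \<in> I. A i = p}) = I"
    by auto
  have "\<not> |A ` I| <o \<kappa>"
  proof
    assume "|A ` I| <o \<kappa>"
    then have "|I| \<le>o \<kappa>"
      using UNION_Cinfinite_bound[of "A ` I" \<kappa> "\<lambda>p. {i \<in> I. A i = p}"] fibres assms(1) fibres_cover
      by (simp add: ordLess_imp_ordLeq)
    then show False
      using assms(2) not_ordLess_ordLeq by blast
  qed
  then have card_le: "\<kappa> \<le>o |A ` I|"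
    using assms(1) by (simp add: not_card_of_ordLess_iff)
  then have "Cinfinite |A ` I|"
    using assms(1) cinfinite_mono card_of_Card_order by blast
  then have "|I| \<le>o |A ` I|"
    using UNION_Cinfinite_bound[of "A ` I" "|A ` I|" "\<lambda>p. {i \<in> I. A i = p}"]
      ordLeq_transitive[OF fibres card_le] fibres_cover
    by (simp add: ordLeq_refl card_of_Card_order)
  then show ?thesis
    using card_of_image by (simp add: ordIso_iff_ordLeq)
qed

lemma singleton_in_small_subsets:
  assumes "Cinfinite \<kappa>" and "i \<in> Field \<nu>"
  shows "{i} \<in> small_subsets \<nu> \<kappa>"
proof -
  have "Cfinite |{i}|"
    by (simp add: cfinite_def Field_card_of card_of_card_order_on)
  then have "|{i}| <o \<kappa>"
    using assms(1) by (rule Cfinite_ordLess_Cinfinite)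
  with assms(2) show ?thesis
    by (simp add: small_subsets_def)
qed

lemma unbounded_subset_mono:
  assumes "unbounded_subset P le X" and "X \<subseteq> Y" and "Y \<subseteq> P"
  shows "unbounded_subset P le Y"
  using assms unfolding unbounded_subset_def by (meson in_mono)

lemma unbounded_subset_if_dominates:
  assumes "transp_on P le" and "unbounded_subset P le X" and "Y \<subseteq> P"
    and "\<And>x. x \<in> X \<Longrightarrow> \<exists>y \<in> Y. le x y"
  shows "unbounded_subset P le Y"
proof -
  have "\<not> (\<exists>b \<in> P. \<forall>y \<in> Y. le y b)"
  proof
    assume "\<exists>b \<in> P. \<forall>y \<in> Y. le y b"
    then obtain b where b: "b \<in> P" "\<forall>y \<in> Y. le y b"
      by blast
    have "le x b" if "x \<in> X" for x
    proof -
      obtain y where "y \<in> Y" "le x y"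
        using \<open>x \<in> X\<close> assms(4) by blast
      moreover have "x \<in> P"
        using \<open>x \<in> X\<close> assms(2) by (auto simp: unbounded_subset_def)
      ultimately show ?thesis
        using assms(3) b by (blast intro: transp_onD[OF assms(1)])
    qed
    then show False
      using b(1) assms(2) by (auto simp: unbounded_subset_def)
  qed
  with assms(3) show ?thesis
    by (simp add: unbounded_subset_def)
qed

lemma unbounded_small_subsets_iff:
  assumes "Card_order \<kappa>" and "X \<subseteq> small_subsets \<nu> \<kappa>"
  shows "unbounded_subset (small_subsets \<nu> \<kappa>) (\<subseteq>) X \<longleftrightarrow> \<kappa> \<le>o |\<Union>X|"
proof -
  have "(\<exists>b \<in> small_subsets \<nu> \<kappa>. \<forall>x \<in> X. x \<subseteq> b) \<longleftrightarrow> |\<Union>X| <o \<kappa>"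
  proof
    assume "\<exists>b \<in> small_subsets \<nu> \<kappa>. \<forall>x \<in> X. x \<subseteq> b"
    then obtain b where b: "|b| <o \<kappa>" "\<Union>X \<subseteq> b"
      by (auto simp: small_subsets_def)
    show "|\<Union>X| <o \<kappa>"
      using card_of_mono1[OF b(2)] b(1) by (rule ordLeq_ordLess_trans)
  next
    assume "|\<Union>X| <o \<kappa>"
    with assms(2) have "\<Union>X \<in> small_subsets \<nu> \<kappa>"
      by (auto simp: small_subsets_def)
    then show "\<exists>b \<in> small_subsets \<nu> \<kappa>. \<forall>x \<in> X. x \<subseteq> b"
      by blast
  qed
  then show ?thesis
    using assms by (simp add: unbounded_subset_def flip: not_card_of_ordLess_iff)
qed

lemma unbounded_singletons_iff:
  assumes "Cinfinite \<kappa>" and "J \<subseteq> Field \<nu>"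
  shows "unbounded_subset (small_subsets \<nu> \<kappa>) (\<subseteq>) ((\<lambda>i. {i}) ` J) \<longleftrightarrow> \<kappa> \<le>o |J|"
proof -
  have "(\<lambda>i. {i}) ` J \<subseteq> small_subsets \<nu> \<kappa>"
    using assms by (auto intro: singleton_in_small_subsets)
  then show ?thesis
    using assms(1) by (simp add: unbounded_small_subsets_iff)
qed

definition card_directed :: "'k rel \<Rightarrow> 'p set \<Rightarrow> ('p \<Rightarrow> 'p \<Rightarrow> bool) \<Rightarrow> bool" where
  "card_directed \<kappa> P le \<longleftrightarrow> (\<forall>X \<subseteq> P. |X| <o \<kappa> \<longrightarrow> (\<exists>b \<in> P. \<forall>x \<in> X. le x b))"

lemma tukey_le_small_subsets:
  assumes "Cinfinite \<kappa>" and "card_directed \<kappa> P le" and "|P| \<le>o |Field \<nu>|"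
  shows "tukey_le P le (small_subsets \<nu> \<kappa>) (\<subseteq>)"
proof -
  obtain g where g: "inj_on g P" "g ` P \<subseteq> Field \<nu>"
    using assms(3) unfolding card_of_ordLeq[symmetric] by blast
  have "unbounded_subset (small_subsets \<nu> \<kappa>) (\<subseteq>) ((\<lambda>x. {g x}) ` X)"
    if "unbounded_subset P le X" for X
  proof -
    have X: "X \<subseteq> P" "\<not> |X| <o \<kappa>"
      using that assms(2) unfolding unbounded_subset_def card_directed_def by blast+
    have "\<kappa> \<le>o |X|"
      using X(2) assms(1) by (simp add: not_card_of_ordLess_iff)
    also have "|X| =o |g ` X|"
      using inj_on_subset[OF g(1) X(1)] by (rule card_of_inj_image)
    finally show ?thesis
      using unbounded_singletons_iff[OF assms(1), of "g ` X" \<nu>] g(2) X(1)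
      by (auto simp: image_image)
  qed
  moreover have "(\<lambda>x. {g x}) ` P \<subseteq> small_subsets \<nu> \<kappa>"
    using assms(1) g(2) by (auto intro: singleton_in_small_subsets)
  ultimately show ?thesis
    unfolding tukey_le_def by blast
qed

definition strongly_unbounded ::
  "'k rel \<Rightarrow> 'p set \<Rightarrow> ('p \<Rightarrow> 'p \<Rightarrow> bool) \<Rightarrow> ('i \<Rightarrow> 'p) \<Rightarrow> 'i set \<Rightarrow> bool" where
  "strongly_unbounded \<kappa> P le A I \<longleftrightarrow>
     A ` I \<subseteq> P \<and> (\<forall>J \<subseteq> I. \<kappa> \<le>o |J| \<longrightarrow> unbounded_subset P le (A ` J))"

lemma strongly_unboundedD:
  assumes "strongly_unbounded \<kappa> P le A I" and "J \<subseteq> I" and "\<kappa> \<le>o |J|"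
  shows "unbounded_subset P le (A ` J)"
  using assms by (simp only: strongly_unbounded_def)

lemma strongly_unbounded_iff_card_eq:
  assumes "Card_order \<kappa>"
  shows "strongly_unbounded \<kappa> P le A I \<longleftrightarrow>
    A ` I \<subseteq> P \<and> (\<forall>J \<subseteq> I. |J| =o \<kappa> \<longrightarrow> unbounded_subset P le (A ` J))"
proof (intro iffI conjI allI impI)
  fix J assume "strongly_unbounded \<kappa> P le A I" "J \<subseteq> I" "|J| =o \<kappa>"
  then show "unbounded_subset P le (A ` J)"
    by (blast intro: strongly_unboundedD ordIso_imp_ordLeq ordIso_symmetric)
next
  assume A: "A ` I \<subseteq> P \<and> (\<forall>J \<subseteq> I. |J| =o \<kappa> \<longrightarrow> unbounded_subset P le (A ` J))"
  have "unbounded_subset P le (A ` J)" if J: "J \<subseteq> I" "\<kappa> \<le>o |J|" for J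
  proof -
    have "|Field \<kappa>| \<le>o |J|"
      using card_of_Field_ordIso[OF assms] J(2) by (rule ordIso_ordLeq_trans)
    then obtain K where K: "K \<subseteq> J" "|Field \<kappa>| =o |K|"
      using internalize_card_of_ordLeq2 by blast
    have "|K| =o \<kappa>"
      using ordIso_symmetric[OF K(2)] card_of_Field_ordIso[OF assms] by (rule ordIso_transitive)
    then have "unbounded_subset P le (A ` K)"
      using A K(1) J(1) by blast
    moreover have "A ` K \<subseteq> A ` J" "A ` J \<subseteq> P"
      using A K(1) J(1) by blast+
    ultimately show ?thesis
      by (rule unbounded_subset_mono)
  qed
  with A show "strongly_unbounded \<kappa> P le A I"
    by (simp add: strongly_unbounded_def)
qed (simp add: strongly_unbounded_def)

lemma tukey_le_strongly_unboundedE: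
  assumes "Cinfinite \<kappa>" and "tukey_le (small_subsets \<nu> \<kappa>) (\<subseteq>) P le"
  obtains A where "strongly_unbounded \<kappa> P le A (Field \<nu>)"
proof -
  obtain f where f: "f ` small_subsets \<nu> \<kappa> \<subseteq> P"
    and unb: "\<And>X. unbounded_subset (small_subsets \<nu> \<kappa>) (\<subseteq>) X \<Longrightarrow> unbounded_subset P le (f ` X)"
    using assms(2) unfolding tukey_le_def by blast
  have "(\<lambda>i. f {i}) ` Field \<nu> \<subseteq> P"
    using assms(1) by (intro image_subsetI subsetD[OF f] imageI singleton_in_small_subsets)
  moreover have "unbounded_subset P le ((\<lambda>i. f {i}) ` J)" if "J \<subseteq> Field \<nu>" "\<kappa> \<le>o |J|" for J
  proof -
    have "unbounded_subset P le (f ` (\<lambda>i. {i}) ` J)"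
      using unb that unbounded_singletons_iff[OF assms(1)] by blast
    then show ?thesis
      by (simp add: image_image)
  qed
  ultimately have "strongly_unbounded \<kappa> P le (\<lambda>i. f {i}) (Field \<nu>)"
    by (simp add: strongly_unbounded_def)
  then show thesis
    by (rule that)
qed

lemma tukey_le_if_strongly_unbounded:
  assumes "Card_order \<kappa>" and "transp_on P le" and "card_directed \<kappa> P le"
    and A: "strongly_unbounded \<kappa> P le A (Field \<nu>)"
  shows "tukey_le (small_subsets \<nu> \<kappa>) (\<subseteq>) P le"
proof -
  have A_in: "A ` Field \<nu> \<subseteq> P"
    using A by (simp add: strongly_unbounded_def)
  have "\<exists>b. b \<in> P \<and> (\<forall>i \<in> S. le (A i) b)" if "S \<in> small_subsets \<nu> \<kappa>" for S
  proof -
    have S: "S \<subseteq> Field \<nu>" "|S| <o \<kappa>"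
      using that by (auto simp: small_subsets_def)
    have "|A ` S| <o \<kappa>"
      using card_of_image S(2) by (rule ordLeq_ordLess_trans)
    moreover have "A ` S \<subseteq> P"
      using S(1) A_in by blast
    ultimately have "\<exists>b \<in> P. \<forall>x \<in> A ` S. le x b"
      using assms(3) by (simp only: card_directed_def)
    then show ?thesis
      by auto
  qed
  then obtain f where f: "f S \<in> P" "\<forall>i \<in> S. le (A i) (f S)" if "S \<in> small_subsets \<nu> \<kappa>" for S
    by metis
  have "unbounded_subset P le (f ` X)" if unb: "unbounded_subset (small_subsets \<nu> \<kappa>) (\<subseteq>) X" for X
  proof -
    have X: "X \<subseteq> small_subsets \<nu> \<kappa>"
      using unb by (simp add: unbounded_subset_def)
    then have "\<kappa> \<le>o |\<Union>X|"
      using unb unbounded_small_subsets_iff[OF assms(1)] by blast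
    moreover have "\<Union>X \<subseteq> Field \<nu>"
      using X by (auto simp: small_subsets_def)
    ultimately have "unbounded_subset P le (A ` \<Union>X)"
      using A by (blast intro: strongly_unboundedD)
    moreover have "f ` X \<subseteq> P"
      using X f(1) by blast
    moreover have "\<exists>q \<in> f ` X. le p q" if "p \<in> A ` \<Union>X" for p
      using that X f(2) by blast
    ultimately show ?thesis
      by (rule unbounded_subset_if_dominates[OF assms(2)])
  qed
  with f(1) show ?thesis
    unfolding tukey_le_def by blast
qed

lemma small_subsets_tukey_le_iff:
  assumes "Cinfinite \<kappa>" and "transp_on P le" and "card_directed \<kappa> P le"
  shows "tukey_le (small_subsets \<nu> \<kappa>) (\<subseteq>) P le \<longleftrightarrow>
    (\<exists>A. strongly_unbounded \<kappa> P le A (Field \<nu>))"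
proof
  assume "tukey_le (small_subsets \<nu> \<kappa>) (\<subseteq>) P le"
  with assms(1) obtain A where "strongly_unbounded \<kappa> P le A (Field \<nu>)"
    by (rule tukey_le_strongly_unboundedE)
  then show "\<exists>A. strongly_unbounded \<kappa> P le A (Field \<nu>)"
    by blast
next
  assume "\<exists>A. strongly_unbounded \<kappa> P le A (Field \<nu>)"
  then show "tukey_le (small_subsets \<nu> \<kappa>) (\<subseteq>) P le"
    using assms by (blast intro: tukey_le_if_strongly_unbounded)
qed

lemma strongly_unbounded_reindex:
  assumes "strongly_unbounded \<kappa> P le A I" and "inj_on h J" and "h ` J \<subseteq> I"
  shows "strongly_unbounded \<kappa> P le (A \<circ> h) J"
  unfolding strongly_unbounded_def
proof (intro conjI allI impI)
  show "(A \<circ> h) ` J \<subseteq> P"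
    using assms by (auto simp: strongly_unbounded_def)
next
  fix K assume K: "K \<subseteq> J" "\<kappa> \<le>o |K|"
  have "|K| =o |h ` K|"
    using inj_on_subset[OF assms(2) K(1)] by (rule card_of_inj_image)
  with K(2) have "\<kappa> \<le>o |h ` K|"
    by (rule ordLeq_ordIso_trans)
  moreover have "h ` K \<subseteq> I"
    using assms(3) K(1) by blast
  ultimately show "unbounded_subset P le ((A \<circ> h) ` K)"
    unfolding image_comp[symmetric] using assms(1) by (blast intro: strongly_unboundedD)
qed

lemma strongly_unbounded_small_fibres:
  assumes "Card_order \<kappa>" and "reflp_on P le" and "strongly_unbounded \<kappa> P le A I" and "p \<in> A ` I"
  shows "|{i \<in> I. A i = p}| <o \<kappa>"
proof (rule ccontr)
  assume "\<not> |{i \<in> I. A i = p}| <o \<kappa>"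
  then have "\<kappa> \<le>o |{i \<in> I. A i = p}|"
    using assms(1) by (simp add: not_card_of_ordLess_iff)
  then have "unbounded_subset P le (A ` {i \<in> I. A i = p})"
    using assms(3) by (blast intro: strongly_unboundedD)
  moreover have "p \<in> P" "le p p"
    using assms(2-4) by (auto simp: strongly_unbounded_def reflp_on_def)
  ultimately show False
    by (auto simp: unbounded_subset_def)
qed

lemma strongly_unbounded_inj_onE:
  assumes "Cinfinite \<kappa>" and "\<kappa> <o |I|" and "reflp_on P le" and "strongly_unbounded \<kappa> P le A I"
  obtains B where "inj_on B I" and "strongly_unbounded \<kappa> P le B I"
proof -
  obtain K where K: "K \<subseteq> I" "inj_on A K" "A ` I = A ` K"
    using subset_image_inj[of "A ` I" A I] by auto
  have "|I| =o |A ` I|"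
  proof (rule ordIso_symmetric[OF card_of_image_if_small_fibres[OF assms(1,2)]])
    show "|{i \<in> I. A i = p}| \<le>o \<kappa>" if "p \<in> A ` I" for p
      using assms(1,3,4) that by (blast intro: strongly_unbounded_small_fibres ordLess_imp_ordLeq)
  qed
  also have "|A ` I| =o |K|"
    unfolding K(3) using K(2) by (rule ordIso_symmetric[OF card_of_inj_image])
  finally obtain h where h: "bij_betw h I K"
    using card_of_ordIso by blast
  show thesis
  proof
    show "inj_on (A \<circ> h) I"
      using h K(2) by (auto simp: bij_betw_def intro: comp_inj_on)
    show "strongly_unbounded \<kappa> P le (A \<circ> h) I"
      using h K(1) by (intro strongly_unbounded_reindex[OF assms(4)]) (auto simp: bij_betw_def)
  qed
qed

lemma tukey_equiv_small_subsets_iff: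
  assumes "Cinfinite \<kappa>" and "reflp_on P le" and "transp_on P le" and "card_directed \<kappa> P le"
    and "|P| \<le>o |Field \<nu>|" and "\<kappa> <o |Field \<nu>|"
  shows "tukey_equiv P le (small_subsets \<nu> \<kappa>) (\<subseteq>) \<longleftrightarrow>
    (\<exists>A. inj_on A (Field \<nu>) \<and> strongly_unbounded \<kappa> P le A (Field \<nu>))"
proof -
  have "tukey_equiv P le (small_subsets \<nu> \<kappa>) (\<subseteq>) \<longleftrightarrow> tukey_le (small_subsets \<nu> \<kappa>) (\<subseteq>) P le"
    using assms(1,4,5) tukey_le_small_subsets by (auto simp: tukey_equiv_def)
  also have "\<dots> \<longleftrightarrow> (\<exists>A. strongly_unbounded \<kappa> P le A (Field \<nu>))"
    using assms(1,3,4) by (rule small_subsets_tukey_le_iff)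
  also have "\<dots> \<longleftrightarrow> (\<exists>A. inj_on A (Field \<nu>) \<and> strongly_unbounded \<kappa> P le A (Field \<nu>))"
    using strongly_unbounded_inj_onE[OF assms(1,6,2)] by blast
  finally show ?thesis .
qed

lemma not_Gal_star_iff_strongly_unbounded:
  assumes "Card_order \<mu>"
  shows "\<not> Gal_star \<kappa> U \<mu> \<nu> \<longleftrightarrow>
    (\<exists>A. inj_on A (Field \<nu>) \<and> strongly_unbounded \<mu> U (supset_star \<kappa>) A (Field \<nu>))"
proof -
  have "strongly_unbounded \<mu> U (supset_star \<kappa>) A (Field \<nu>) \<longleftrightarrow> A ` Field \<nu> \<subseteq> U \<and>
    \<not> (\<exists>J. J \<subseteq> Field \<nu> \<and> |J| =o \<mu> \<and> (\<exists>X \<in> U. \<forall>i \<in> J. subset_star \<kappa> X (A i)))" for A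
  proof -
    have "unbounded_subset U (supset_star \<kappa>) (A ` J) \<longleftrightarrow>
        \<not> (\<exists>X \<in> U. \<forall>i \<in> J. subset_star \<kappa> X (A i))"
      if "A ` Field \<nu> \<subseteq> U" "J \<subseteq> Field \<nu>" for J
      using subset_trans[OF image_mono[OF that(2)] that(1)]
      by (simp add: unbounded_subset_def supset_star_def)
    then show ?thesis
      unfolding strongly_unbounded_iff_card_eq[OF assms] by meson
  qed
  then show ?thesis
    unfolding Gal_star_def by metis
qed

lemma bounded_in_Un:
  assumes "Well_order \<kappa>" and "bounded_in \<kappa> Y" and "bounded_in \<kappa> Z"
  shows "bounded_in \<kappa> (Y \<union> Z)"
proof -
  obtain b c where b: "b \<in> Field \<kappa>" "\<forall>y \<in> Y. (y, b) \<in> \<kappa>"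
    and c: "c \<in> Field \<kappa>" "\<forall>z \<in> Z. (z, c) \<in> \<kappa>"
    using assms(2,3) by (auto simp: bounded_in_def)
  interpret wo_rel \<kappa>
    using assms(1) by (simp add: wo_rel_def)
  have "(x, max2 b c) \<in> \<kappa>" if "x \<in> Y \<union> Z" for x
    using that b c max2_greater[of b c] TRANS by (blast dest: transD)
  moreover have "max2 b c \<in> Field \<kappa>"
    using b(1) c(1) by (simp add: max2_def)
  ultimately show ?thesis
    unfolding bounded_in_def by blast
qed

lemma transp_supset_star:
  assumes "Well_order \<kappa>"
  shows "transp (supset_star \<kappa>)"
proof (rule transpI)
  fix A B C assume "supset_star \<kappa> A B" "supset_star \<kappa> B C"
  then have "bounded_in \<kappa> ((B - A) \<union> (C - B))"
    using assms by (simp add: supset_star_def subset_star_def bounded_in_Un)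
  moreover have "C - A \<subseteq> (B - A) \<union> (C - B)"
    by blast
  ultimately show "supset_star \<kappa> A C"
    unfolding supset_star_def subset_star_def bounded_in_def by blast
qed

lemma supset_star_if_supset:
  assumes "Field \<kappa> \<noteq> {}" and "B \<subseteq> A"
  shows "supset_star \<kappa> A B"
  using assms by (auto simp: supset_star_def subset_star_def bounded_in_def)

lemma card_directed_supset_star:
  assumes "Field \<kappa> \<noteq> {}" and "U \<noteq> {}" and "complete_filter \<mu> U"
  shows "card_directed \<mu> U (supset_star \<kappa>)"
  unfolding card_directed_def
proof (intro allI impI)
  fix X assume X: "X \<subseteq> U" "|X| <o \<mu>"
  show "\<exists>B \<in> U. \<forall>A \<in> X. supset_star \<kappa> A B"
  proof (cases "X = {}")
    case True
    with assms(2) show ?thesis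
      by auto
  next
    case False
    with X assms(3) have "\<Inter>X \<in> U"
      by (simp add: complete_filter_def)
    then show ?thesis
      using supset_star_if_supset[OF assms(1)] by (blast intro: Inter_lower)
  qed
qed

theorem theorem3p16:
  fixes \<kappa> :: "'a rel" and U :: "'a set set"
  assumes "Card_order \<kappa>"
    and "\<kappa> =o natLeq \<or> measurable_cardinal \<kappa>"
    and "ultrafilter_over (Field \<kappa>) U"
    and "complete_filter \<kappa> U"
    and "uniform_filter \<kappa> U"
  shows "tukey_equiv U (supset_star \<kappa>) (small_subsets (ctwo ^c \<kappa>) \<kappa>) (\<subseteq>)
     \<longleftrightarrow> \<not> Gal_star \<kappa> U \<kappa> (ctwo ^c \<kappa>)"
proof -
  have inf: "Cinfinite \<kappa>"
    using assms(2) Cinfinite_cong[OF ordIso_symmetric natLeq_Cinfinite] Cinfinite_if_measurable_cardinal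
    by blast
  then have ne: "Field \<kappa> \<noteq> {}"
    by (auto simp: cinfinite_def)
  have U: "U \<subseteq> Pow (Field \<kappa>)" "U \<noteq> {}"
    using assms(3) by (auto simp: ultrafilter_over_def)
  show ?thesis
    unfolding not_Gal_star_iff_strongly_unbounded[OF assms(1)]
  proof (rule tukey_equiv_small_subsets_iff[OF inf])
    show "reflp_on U (supset_star \<kappa>)"
      using supset_star_if_supset[OF ne] by (simp add: reflp_on_def)
    show "transp_on U (supset_star \<kappa>)"
      using transp_supset_star[OF card_order_on_well_order_on[OF assms(1)]]
      by (rule transp_on_subset) simp
    show "card_directed \<kappa> U (supset_star \<kappa>)"
      using ne U(2) assms(4) by (rule card_directed_supset_star)
    show "|U| \<le>o |Field (ctwo ^c \<kappa>)|"
      using card_of_mono1[OF U(1)] card_of_Pow_Field_ordIso by (rule ordLeq_ordIso_trans)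
    show "\<kappa> <o |Field (ctwo ^c \<kappa>)|"
      using Card_order_Pow[OF assms(1)] card_of_Pow_Field_ordIso by (rule ordLess_ordIso_trans)
  qed
qed

end
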